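(* Let $\{n_k\}_{k=0}^{\infty}$ be a lacunary sequence of positive integers, let $1\leq p<\infty$ and $1\leq q\leq \infty$, and let $\{\alpha_k\}_{k\ge 0}$ be a sequence of complex numbers. Then $$f(z)=\sum_{k=0}^{\infty}\alpha_k z^{n_k}$$ belongs to $RM(p,q)$ if and only if $$\sum_{k=0}^{\infty}\frac{|\alpha_k|^p}{n_k}<+\infty .$$ Moreover, $$\rho_{p,q}(f)\asymp\left(\sum_{k=0}^{\infty}\frac{|\alpha_k|^p}{n_k}\right)^{1/p}.$$
   Context: $\mathbb{D}$ is the open unit disc of $\mathbb{C}$ and $\mathcal{H}(\mathbb{D})$ is the space of holomorphic functions on $\mathbb{D}$. For $1\leq p<\infty$, $RM(p,q)=\{f\in\mathcal{H}(\mathbb{D}):\rho_{p,q}(f)<+\infty\}$, where for $q<+\infty$ $$\rho_{p,q}(f)=\left(\frac{1}{2\pi}\int_0^{2\pi}\left(\int_0^1|f(re^{it})|^p\,dr\right)^{q/p}dt\right)^{1/q},$$ and $\rho_{p,\infty}(f)=\operatorname{ess\,sup}_{t\in[0,2\pi)}\left(\int_0^1|f(re^{it})|^p\,dr\right)^{1/p}$. A sequence of positive numbers $\{x_k\}$ is lacunary if there is a constant $\lambda$ such that $\frac{x_{k+1}}{x_k}\geq\lambda>1$ for all $k$. "$f$ belongs to $RM(p,q)$" means that the power series converges in $\mathbb{D}$ and its sum is in $RM(p,q)$. The notation $a\asymp b$ means $C^{-1}b\le a\le Cb$ for a constant $C>0$ which depends only on the parameters (here $p$, $q$ and the sequence $\{n_k\}$),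 not on the coefficients $\{\alpha_k\}$. *)

theory Defs
  imports "HOL-Complex_Analysis.Complex_Analysis" "HOL-Probability.Essential_Supremum"
begin

(* Real powers on [0, infinity], meant for exponents a > 0 only:
   infinity to the power a is infinity, 0 to the power a is 0. *)
definition ennreal_powr :: "ennreal \<Rightarrow> real \<Rightarrow> ennreal" where
  "ennreal_powr x a = (if x = top then top else ennreal (enn2real x powr a))"

(* The integral of |f(r e^{it})|^p over 0 <= r < 1. The point r = 1 is left out because
   f is only meaningful on the open unit disc; the integral does not change. *)
definition radial_integral :: "real \<Rightarrow> (complex \<Rightarrow> complex) \<Rightarrow> real \<Rightarrow> ennreal" where
  "radial_integral p f t =
     (\<integral>\<^sup>+ r \<in> {0..<1}. ennreal (norm (f (of_real r * cis t)) powr p) \<partial>lborel)"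

(* Intended for 1 <= p and 1 <= q <= infinity; a holomorphic f outside RM(p,q) gets infinity. *)
definition rho :: "real \<Rightarrow> ennreal \<Rightarrow> (complex \<Rightarrow> complex) \<Rightarrow> ennreal" where
  "rho p q f =
     (if q = top
      then esssup (restrict_space lborel {0..<2 * pi}) (\<lambda>t. ennreal_powr (radial_integral p f t) (1 / p))
      else ennreal_powr
             (ennreal (1 / (2 * pi)) *
                (\<integral>\<^sup>+ t \<in> {0..2 * pi}. ennreal_powr (radial_integral p f t) (enn2real q / p) \<partial>lborel))
             (1 / enn2real q))"

definition RM :: "real \<Rightarrow> ennreal \<Rightarrow> (complex \<Rightarrow> complex) set" where
  "RM p q = {f. f holomorphic_on ball 0 1 \<and> rho p q f < top}"

definition lacunary :: "(nat \<Rightarrow> real) \<Rightarrow> bool" where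
  "lacunary x \<longleftrightarrow> (\<forall>k. 0 < x k) \<and> (\<exists>l>1. \<forall>k. x (Suc k) / x k \<ge> l)"

definition converges_in_disc :: "(nat \<Rightarrow> nat) \<Rightarrow> (nat \<Rightarrow> complex) \<Rightarrow> bool" where
  "converges_in_disc n \<alpha> \<longleftrightarrow> (\<forall>z \<in> ball 0 1. summable (\<lambda>k. \<alpha> k * z ^ n k))"

(* Only meaningful at z in the unit disc when converges_in_disc n \<alpha> holds. *)
definition gap_series :: "(nat \<Rightarrow> nat) \<Rightarrow> (nat \<Rightarrow> complex) \<Rightarrow> complex \<Rightarrow> complex" where
  "gap_series n \<alpha> z = (\<Sum>k. \<alpha> k * z ^ n k)"

end

theory Submission
  imports Defs
begin

text \<open>
  Upper bound, uniformly in $t$: Jensen's inequality with weights $n_k^d r^{n_k}$, $d = 1/(2p)$,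
  together with $\sum_k n_k^d r^{n_k} \le C (1-r)^{-d}$ (lacunarity), bounds $(\sum_k |\alpha_k| r^{n_k})^p$
  by a constant times $(1-r)^{-d(p-1)} \sum_k |\alpha_k|^p n_k^{-d(p-1)} r^{n_k}$; integrating in $r$ gives
  $\sum_k |\alpha_k|^p / n_k$, because $\int_0^1 (1-r)^{-e} r^m dr \le 3 m^{e-1}$ for $0 \le e \le 1/2$.

  Lower bound: as $\rho_{p,q} \ge \rho_{p,1}$, take $q = 1$. Pair $|f(re^{it})|$, as a function of $r$, with
  $h^{p-1}$, where $h$ is proportional to $|\alpha_k|$ on the disjoint intervals
  $I_k = [1 - 1/(2n_k), 1 - 1/(2n_{k+1}))$. After averaging in $t$ it suffices that the circle mean
  of $|f|$ is at least $|\alpha_k| r^{n_k} \ge |\alpha_k|/2$ on $I_k$, and that $|I_k|$ is comparable to $1/n_k$.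
\<close>

section \<open>Real powers of extended nonnegative numbers\<close>

lemma ennreal_powr_ennreal: "0 \<le> x \<Longrightarrow> ennreal_powr (ennreal x) a = ennreal (x powr a)"
  by (simp add: ennreal_powr_def)

lemma ennreal_powr_top [simp]: "ennreal_powr top a = top"
  by (simp add: ennreal_powr_def)

lemma ennreal_powr_zero [simp]: "ennreal_powr 0 a = 0"
  by (simp add: ennreal_powr_def)

lemma ennreal_powr_less_top_iff: "ennreal_powr x a < top \<longleftrightarrow> x < top"
  by (simp add: ennreal_powr_def less_top)

lemma ennreal_powr_mono:
  assumes "0 \<le> a" "x \<le> y"
  shows "ennreal_powr x a \<le> ennreal_powr y a"
  using assms
  by (cases x; cases y) (auto simp: ennreal_powr_ennreal top_unique intro!: ennreal_leI powr_mono2)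

lemma ennreal_powr_powr:
  "ennreal_powr (ennreal_powr x a) b = ennreal_powr x (a * b)"
  by (cases x) (auto simp: ennreal_powr_ennreal powr_powr)

lemma ennreal_powr_one [simp]: "ennreal_powr x 1 = x"
  by (cases x) (auto simp: ennreal_powr_ennreal)

lemma ennreal_powr_cmult:
  assumes "0 < c"
  shows "ennreal_powr (ennreal c * x) a = ennreal (c powr a) * ennreal_powr x a"
  using assms
  by (cases x) (auto simp: ennreal_powr_ennreal ennreal_mult_top powr_mult simp flip: ennreal_mult)

lemma measurable_ennreal_powr [measurable]:
  assumes [measurable]: "F \<in> borel_measurable M"
  shows "(\<lambda>x. ennreal_powr (F x) a) \<in> borel_measurable M"
  unfolding ennreal_powr_def by measurable

section \<open>The inequalities of Young, Hoelder and Jensen\<close>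

text \<open>Weighted arithmetic-geometric mean inequality for \<open>a powr p\<close> and
  \<open>b powr p\<close> with weights 1/p and 1 - 1/p. Writing \<open>b powr (p - 1)\<close> avoids
  the conjugate exponent, which is infinite for \<open>p = 1\<close>.\<close>

lemma young_powr:
  fixes a b p :: real
  assumes "1 \<le> p" "0 \<le> a" "0 \<le> b"
  shows "a * b powr (p - 1) \<le> a powr p / p + (1 - 1 / p) * b powr p"
proof (cases "a = 0 \<or> b = 0")
  \<comment> \<open>For \<open>b = 0\<close> the left side vanishes even when \<open>p = 1\<close>,
    because \<open>0 powr 0 = 0\<close>.\<close>
  case True
  then show ?thesis using assms by (auto simp: divide_simps)
next
  case False
  then have "(a powr p) powr (1/p) * (b powr p) powr (1 - 1/p)
      \<le> (1/p) * a powr p + (1 - 1/p) * b powr p"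
    using assms by (intro Youngs_inequality_0) auto
  moreover have "p * (1 - 1/p) = p - 1" using assms by (simp add: field_simps)
  ultimately show ?thesis using assms by (simp add: powr_powr)
qed

text \<open>On a probability space, taking $h = 1$ gives the monotonicity of power means.\<close>
lemma holder_dual:
  assumes p: "1 \<le> p" and F[measurable]: "F \<in> borel_measurable M"
    and h[measurable]: "h \<in> borel_measurable M" and h0: "\<And>x. 0 \<le> h x"
    and H: "(\<integral>\<^sup>+x. ennreal (h x powr p) \<partial>M) \<le> 1"
  shows "(\<integral>\<^sup>+x. F x * ennreal (h x powr (p - 1)) \<partial>M)
      \<le> ennreal_powr (\<integral>\<^sup>+x. ennreal_powr (F x) p \<partial>M) (1 / p)"
proof (cases "(\<integral>\<^sup>+x. ennreal_powr (F x) p \<partial>M)")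
  case top
  then show ?thesis by (simp add: ennreal_powr_def)
next
  case (real X)
  \<comment> \<open>Working with any s > 0 such that s^p \<ge> X, instead of X^(1/p) itself, allows
    division by s also when X = 0; afterwards s decreases to X^(1/p).\<close>
  have le: "(\<integral>\<^sup>+x. F x * ennreal (h x powr (p - 1)) \<partial>M) \<le> ennreal s"
    if s: "0 < s" "X \<le> s powr p" for s
  proof -
    \<comment> \<open>Young for F/s and h, multiplied by s. After integration the bracket is at most
      1/p + (1 - 1/p) = 1.\<close>
    have pw: "F x * ennreal (h x powr (p - 1)) \<le>
        ennreal s * (ennreal (1 / (p * s powr p)) * ennreal_powr (F x) p + ennreal (1 - 1/p) * ennreal (h x powr p))" for x
    proof (cases "F x")
      case top
      then show ?thesis using p s by (simp add: ennreal_mult_top)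
    next
      case (real y)
      have "y * h x powr (p - 1) = s * ((y / s) * h x powr (p - 1))" using s by simp
      also have "\<dots> \<le> s * ((y/s) powr p / p + (1 - 1/p) * h x powr p)"
        using s real p h0 by (intro mult_left_mono young_powr) auto
      also have "\<dots> = s * (1 / (p * s powr p) * y powr p + (1 - 1/p) * h x powr p)"
        using s real by (simp add: powr_divide field_simps)
      finally show ?thesis using real p s h0[of x]
        by (auto simp: ennreal_powr_ennreal simp flip: ennreal_mult ennreal_plus intro!: ennreal_leI)
    qed
    have "(\<integral>\<^sup>+x. F x * ennreal (h x powr (p - 1)) \<partial>M) \<le>
       (\<integral>\<^sup>+x. ennreal s * (ennreal (1 / (p * s powr p)) * ennreal_powr (F x) p + ennreal (1 - 1/p) * ennreal (h x powr p)) \<partial>M)"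
      by (intro nn_integral_mono pw)
    also have "\<dots> = ennreal s * (ennreal (1 / (p * s powr p)) * ennreal X + ennreal (1 - 1/p) * (\<integral>\<^sup>+x. ennreal (h x powr p) \<partial>M))"
      using real by (simp add: nn_integral_cmult nn_integral_add)
    also have "\<dots> \<le> ennreal s * (ennreal (1 / (p * s powr p)) * ennreal (s powr p) + ennreal (1 - 1/p) * 1)"
      using s p H by (intro mult_left_mono add_mono ennreal_leI) auto
    also have "\<dots> = ennreal s"
      using s p by (simp flip: ennreal_mult ennreal_plus)
    finally show ?thesis .
  qed
  have "(\<integral>\<^sup>+x. F x * ennreal (h x powr (p - 1)) \<partial>M) \<le> ennreal (X powr (1/p))"
  proof (rule ennreal_le_epsilon)
    fix e :: real assume e: "0 < e"
    have "(\<integral>\<^sup>+x. F x * ennreal (h x powr (p - 1)) \<partial>M) \<le> ennreal (X powr (1/p) + e)"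
    proof (rule le)
      show "0 < X powr (1/p) + e" using e by (simp add: add_nonneg_pos)
      have "X = (X powr (1/p)) powr p" using p real by (simp add: powr_powr)
      also have "\<dots> \<le> (X powr (1/p) + e) powr p" using p e by (intro powr_mono2) auto
      finally show "X \<le> (X powr (1/p) + e) powr p" .
    qed
    then show "(\<integral>\<^sup>+x. F x * ennreal (h x powr (p - 1)) \<partial>M) \<le> ennreal (X powr (1/p)) + ennreal e"
      using e by (simp add: ennreal_plus)
  qed
  then show ?thesis using real by (simp add: ennreal_powr_ennreal)
qed

text \<open>Let W be the total weight and divide the b_i by s, where s^p is the weighted mean of the
  b_i^p. The tangent line inequality x \<le> x^p/p + 1 - 1/p, summed with the weights, then bounds
  the sum of w_i b_i by s W. The weights are not normalised, whence the factor W^(p-1).\<close>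

lemma jensen_powr_sum:
  fixes w b :: "'a \<Rightarrow> real"
  assumes p: "1 \<le> p" and "finite A" and w: "\<And>i. i \<in> A \<Longrightarrow> 0 \<le> w i" and b: "\<And>i. i \<in> A \<Longrightarrow> 0 \<le> b i"
  shows "(\<Sum>i\<in>A. w i * b i) powr p \<le> (\<Sum>i\<in>A. w i) powr (p - 1) * (\<Sum>i\<in>A. w i * b i powr p)"
proof (cases "(\<Sum>i\<in>A. w i) = 0")
  case True
  then have "w i = 0" if "i \<in> A" for i using w that assms(2) by (simp add: sum_nonneg_eq_0_iff)
  then show ?thesis by simp
next
  case False
  define W B where "W = (\<Sum>i\<in>A. w i)" and "B = (\<Sum>i\<in>A. w i * b i powr p)"
  have W: "0 < W" using False w unfolding W_def by (metis sum_nonneg less_eq_real_def)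
  show ?thesis
  proof (cases "B = 0")
    case True
    then have "w i * b i powr p = 0" if "i \<in> A" for i
      using w that assms(2) unfolding B_def by (simp add: sum_nonneg_eq_0_iff)
    then have "(\<Sum>i\<in>A. w i * b i) = 0" by (intro sum.neutral) auto
    then show ?thesis using True by (simp add: B_def)
  next
    case False
    have "0 \<le> B" unfolding B_def using w by (intro sum_nonneg) auto
    with False have B: "0 < B" by simp
    define s where "s = (B / W) powr (1 / p)"
    have s: "0 < s" "s powr p = B / W" using B W p by (simp_all add: s_def powr_powr)
    have "(\<Sum>i\<in>A. w i * (b i / s)) \<le> (\<Sum>i\<in>A. w i * ((b i / s) powr p / p + (1 - 1 / p)))"
    proof (intro sum_mono mult_left_mono)
      fix i assume i: "i \<in> A"
      show "b i / s \<le> (b i / s) powr p / p + (1 - 1 / p)"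
        using young_powr[of p "b i / s" 1] p s b[OF i] by simp
    qed (use w in auto)
    also have "\<dots> = (\<Sum>i\<in>A. w i * b i powr p / (s powr p * p) + w i * (1 - 1 / p))"
      using s b by (intro sum.cong refl) (simp add: powr_divide distrib_left)
    also have "\<dots> = B / (s powr p * p) + W * (1 - 1 / p)"
      by (simp add: sum.distrib B_def W_def flip: sum_divide_distrib sum_distrib_right)
    also have "\<dots> = W" using B W p s by (simp add: field_simps)
    finally have "(\<Sum>i\<in>A. w i * b i) \<le> s * W"
      using s by (simp add: field_simps flip: sum_divide_distrib)
    then have "(\<Sum>i\<in>A. w i * b i) powr p \<le> (s * W) powr p"
      using p w b by (intro powr_mono2 sum_nonneg) auto
    also have "\<dots> = W powr (p - 1) * B" using s W by (simp add: powr_mult powr_diff)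
    finally show ?thesis by (simp add: W_def B_def)
  qed
qed

section \<open>Elementary sums and integrals on the unit interval\<close>

text \<open>Each of the m terms r^j with j < m is at least r^m, and their sum times 1 - r is 1 -
  r^m.\<close>

lemma of_nat_mult_power_le:
  fixes r :: real
  assumes "0 \<le> r" "r \<le> 1"
  shows "real m * (1 - r) * r ^ m \<le> 1"
proof -
  have "real m * r ^ m = (\<Sum>j<m. r ^ m)" by simp
  also have "\<dots> \<le> (\<Sum>j<m. r ^ j)" using assms by (intro sum_mono power_decreasing) auto
  finally have "real m * r ^ m * (1 - r) \<le> (\<Sum>j<m. r ^ j) * (1 - r)"
    using assms by (intro mult_right_mono) auto
  also have "\<dots> = 1 - r ^ m" by (simp add: one_diff_power_eq mult.commute)
  also have "\<dots> \<le> 1" using assms by simp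
  finally show ?thesis by (simp add: ac_simps)
qed

text \<open>As long as y_k \<le> 1 the terms y_k grow geometrically up to at most 1; from then on
  the terms 1/y_k decay geometrically. Each of the two stretches contributes at most c = 1/(1 -
  1/m), the sum of the geometric series with ratio 1/m.\<close>

lemma sum_min_inverse_geometric_le:
  fixes y :: "nat \<Rightarrow> real"
  assumes m: "1 < m" and y: "\<And>k. 0 < y k" and step: "\<And>k. m * y k \<le> y (Suc k)"
  shows "(\<Sum>k<K. min (y k) (1 / y k)) \<le> 2 / (1 - 1 / m)"
proof -
  define c where "c = 1 / (1 - 1 / m)"
  have c: "1 < c" "c / m = c - 1" using m by (auto simp: c_def divide_simps)
  have mono: "y k \<le> y (Suc k)" for k
    using step[of k] m y[of k] by (smt (verit) mult_less_cancel_right1)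
  have cy: "c * y k \<le> (c - 1) * y (Suc k)" for k
  proof -
    have "(c / m) * (m * y k) \<le> (c / m) * y (Suc k)" using c m step by (intro mult_left_mono) auto
    also have "(c / m) * y (Suc k) = (c - 1) * y (Suc k)" by (simp only: c(2))
    finally show ?thesis using m by simp
  qed
  \<comment> \<open>The bound (c - 1) y_K drives the induction: adding y_K gives c y_K, which is at
    most (c - 1) y_(K+1) by \<open>cy\<close>. The bound c is what remains once y_K exceeds
    1.\<close>
  have small: "(\<Sum>k<K. if y k \<le> 1 then y k else 0) \<le> min c ((c - 1) * y K)" for K
  proof (induction K)
    case 0
    then show ?case using c y[of 0] by simp
  next
    case (Suc K)
    show ?case
    proof (cases "y K \<le> 1")
      case True
      then have "(\<Sum>k<Suc K. if y k \<le> 1 then y k else 0) \<le> c * y K"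
        using Suc by (simp add: algebra_simps)
      moreover have "c * y K \<le> c" using c True y[of K] by simp
      ultimately show ?thesis using cy[of K] by simp
    next
      case False
      moreover have "(c - 1) * y K \<le> (c - 1) * y (Suc K)" using mono c by (intro mult_left_mono) auto
      ultimately show ?thesis using Suc by simp
    qed
  qed
  \<comment> \<open>The right side telescopes: for y_K > 1 it grows by c/y_K - c/y_(K+1), which is
    at least 1/y_K by \<open>cy\<close>. The maximum with 1 makes it start from 0.\<close>
  have large: "(\<Sum>k<K. if y k \<le> 1 then 0 else 1 / y k) \<le> c * (1 - 1 / max 1 (y K))" for K
  proof (induction K)
    case 0
    then show ?case using c by simp
  next
    case (Suc K)
    show ?case
    proof (cases "y K \<le> 1")
      case True
      have "0 \<le> c * (1 - 1 / max 1 (y (Suc K)))" using c by simp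
      then show ?thesis using Suc True by simp
    next
      case False
      have "c / y (Suc K) \<le> (c - 1) / y K"
        using cy[of K] y[of K] y[of "Suc K"] by (simp add: field_simps)
      moreover have "max 1 (y K) = y K" "max 1 (y (Suc K)) = y (Suc K)" using False mono[of K] by auto
      ultimately show ?thesis using Suc False by (simp add: right_diff_distrib diff_divide_distrib)
    qed
  qed
  have "(\<Sum>k<K. min (y k) (1 / y k)) =
      (\<Sum>k<K. if y k \<le> 1 then y k else 0) + (\<Sum>k<K. if y k \<le> 1 then 0 else 1 / y k)"
    unfolding sum.distrib[symmetric]
  proof (intro sum.cong refl)
    fix k
    have "y k \<le> 1 \<longleftrightarrow> y k \<le> 1 / y k"
      using y[of k] by (simp add: pos_le_divide_eq) (smt (verit) mult_le_one mult_less_cancel_left1 mult_less_cancel_right1)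
    then show "min (y k) (1 / y k) = (if y k \<le> 1 then y k else 0) + (if y k \<le> 1 then 0 else 1 / y k)"
      by (auto simp: min_def)
  qed
  also have "\<dots> \<le> c + c * 1"
    using small[of K] large[of K] c by (intro add_mono) (auto elim!: order_trans intro!: mult_left_mono)
  finally show ?thesis by (simp add: c_def)
qed

text \<open>The reflection x = 1 - r turns this into the integral of x^(-b) over [0, c], which
  converges because b < 1.\<close>

lemma nn_integral_one_minus_powr:
  fixes b c :: real
  assumes b: "b < 1" and c: "0 \<le> c"
  shows "(\<integral>\<^sup>+r. ennreal ((1 - r) powr (-b)) * indicator {1 - c..1} r \<partial>lborel) = ennreal (c powr (1 - b) / (1 - b))"
proof -
  have "((\<lambda>x. x powr (-b)) has_integral (c powr (-b+1) / (-b+1))) {0..c}"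
    using b c by (intro has_integral_powr_from_0) auto
  then have "(\<integral>\<^sup>+x. ennreal (x powr (-b)) * indicator {0..c} x \<partial>lborel) = ennreal (c powr (1 - b) / (1 - b))"
    using nn_integral_has_integral_lebesgue[of "{0..c}" "\<lambda>x. x powr (-b)"]
    by (simp add: nn_integral_set_ennreal add.commute mult.commute)
  moreover have "(\<integral>\<^sup>+x. ennreal (x powr (-b)) * indicator {0..c} x \<partial>lborel)
     = (\<integral>\<^sup>+r. ennreal ((1 - r) powr (-b)) * indicator {0..c} (1 - r) \<partial>lborel)"
    by (subst nn_integral_real_affine[where c = "-1" and t = 1]) auto
  moreover have "indicator {0..c} (1 - r) = (indicator {1 - c..1} r :: ennreal)" for r
    by (auto simp: indicator_def)
  ultimately show ?thesis by simp
qed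

lemma nn_integral_power_lborel:
  "(\<integral>\<^sup>+r. ennreal (r ^ m) * indicator {0..1} r \<partial>lborel) = ennreal (1 / real (Suc m))"
proof -
  have "(\<integral>\<^sup>+r. ennreal (r ^ m) * indicator {0..1} r \<partial>lborel)
      = ennreal (1 ^ Suc m / real (Suc m) - 0 ^ Suc m / real (Suc m))"
  proof (intro nn_integral_FTC_Icc)
    fix r :: real
    show "((\<lambda>r. r ^ Suc m / real (Suc m)) has_real_derivative r ^ m) (at r)"
      by (auto intro!: derivative_eq_intros simp del: of_nat_Suc power_Suc)
  qed auto
  then show ?thesis by simp
qed

text \<open>Split at r = 1 - 1/m. Below, (1 - r)^(-b) \<le> m^b and r^m integrates to 1/(m+1);
  above, r^m \<le> 1 and the singular factor is integrated exactly. The two pieces are at most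
  m^(b-1) and m^(b-1)/(1 - b), and b \<le> 1/2 makes their sum at most 3 m^(b-1).\<close>

lemma nn_integral_one_minus_powr_power_le:
  fixes b :: real
  assumes b: "0 \<le> b" "b \<le> 1/2" and m: "0 < m"
  shows "(\<integral>\<^sup>+r \<in> {0..<1}. ennreal ((1 - r) powr (-b) * r ^ m) \<partial>lborel) \<le> ennreal (3 * real m powr (b - 1))"
proof -
  have pw: "ennreal ((1 - r) powr (-b) * r ^ m) * indicator {0..<1} r \<le>
      ennreal (real m powr b) * (ennreal (r ^ m) * indicator {0..1} r)
      + ennreal ((1 - r) powr (-b)) * indicator {1 - 1 / real m..1} r" for r :: real
  proof (cases "r \<in> {0..<1}")
    case True
    then have r: "0 \<le> r" "r < 1" by auto
    show ?thesis
    proof (cases "r < 1 - 1 / real m")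
      case True
      then have "1 / real m \<le> 1 - r" by simp
      then have "(1 - r) powr (-b) \<le> (1 / real m) powr (-b)"
        using b m by (intro powr_mono2') auto
      also have "\<dots> = real m powr b" using m by (simp add: powr_minus powr_divide)
      finally have "(1 - r) powr (-b) * r ^ m \<le> real m powr b * r ^ m"
        using r by (intro mult_right_mono) auto
      then show ?thesis using r True by (auto simp flip: ennreal_mult intro!: ennreal_leI)
    next
      case False
      have "(1 - r) powr (-b) * r ^ m \<le> (1 - r) powr (-b)"
        using r by (simp add: mult_left_le power_le_one)
      then show ?thesis using r False by (auto intro!: add_increasing ennreal_leI)
    qed
  qed auto
  have "(\<integral>\<^sup>+r \<in> {0..<1}. ennreal ((1 - r) powr (-b) * r ^ m) \<partial>lborel)
     \<le> (\<integral>\<^sup>+r. ennreal (real m powr b) * (ennreal (r ^ m) * indicator {0..1} r)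
      + ennreal ((1 - r) powr (-b)) * indicator {1 - 1 / real m..1} r \<partial>lborel)"
    by (intro nn_integral_mono pw)
  also have "\<dots> = ennreal (real m powr b * (1 / real (Suc m)) + (1 / real m) powr (1 - b) / (1 - b))"
    using b by (simp add: nn_integral_add nn_integral_cmult nn_integral_power_lborel nn_integral_one_minus_powr
        del: of_nat_Suc) (simp flip: ennreal_mult ennreal_plus)
  also have "\<dots> \<le> ennreal (3 * real m powr (b - 1))"
  proof (rule ennreal_leI)
    have e: "real m powr (b - 1) = real m powr b * (1 / real m)" using m by (simp add: powr_diff)
    have "real m powr b * (1 / real (Suc m)) \<le> real m powr (b - 1)"
      unfolding e using m by (intro mult_left_mono) (auto simp: field_simps)
    moreover have "(1 / real m) powr (1 - b) / (1 - b) = real m powr (b - 1) / (1 - b)"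
      using m by (simp add: powr_divide powr_diff)
    moreover have "real m powr (b - 1) / (1 - b) \<le> 2 * real m powr (b - 1)"
      using b m by (simp add: field_simps)
    ultimately show "real m powr b * (1 / real (Suc m)) + (1 / real m) powr (1 - b) / (1 - b) \<le> 3 * real m powr (b - 1)"
      by linarith
  qed
  finally show ?thesis .
qed

section \<open>Orthogonality of characters, and integration in polar coordinates\<close>

lemma has_bochner_integral_cis:
  fixes m :: int
  shows "has_bochner_integral lborel (\<lambda>t. indicator {0..2 * pi} t *\<^sub>R cis (of_int m * t))
    (if m = 0 then 2 * pi else 0)"
proof (cases "m = 0")
  case True
  have "has_bochner_integral lborel (\<lambda>t. indicator {0..2 * pi} t *\<^sub>R (1 :: complex)) (of_real (2 * pi) - of_real 0)"
    by (intro has_bochner_integral_FTC_Icc) (auto intro!: derivative_eq_intros)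
  then show ?thesis using True by simp
next
  case False
  define F where "F = (\<lambda>t. cis (of_int m * t) / (\<i> * of_int m))"
  have "has_bochner_integral lborel (\<lambda>t. indicator {0..2 * pi} t *\<^sub>R cis (of_int m * t)) (F (2 * pi) - F 0)"
  proof (intro has_bochner_integral_FTC_Icc)
    fix t :: real
    have "((\<lambda>z. exp (\<i> * of_int m * z) / (\<i> * of_int m)) has_field_derivative
        exp (\<i> * of_int m * of_real t)) (at (of_real t))"
      using False by (auto intro!: derivative_eq_intros)
    from has_vector_derivative_real_field[OF this] show "(F has_vector_derivative cis (of_int m * t)) (at t within {0..2 * pi})"
      by (simp add: F_def cis_conv_exp mult.assoc)
  qed (auto intro!: continuous_intros)
  moreover have "F (2 * pi) = F 0"
    using cis_multiple_2pi[of "of_int m"] by (simp add: F_def ac_simps)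
  ultimately show ?thesis using False by simp
qed

text \<open>Extension by zero outside 0 \<le> r < 1 gives a function on the whole plane that is
  measurable whatever the values of f off the disc, so that Tonelli applies on \<open>lborel\<close>
  without restricting the domain.\<close>

definition polar_norm :: "(complex \<Rightarrow> complex) \<Rightarrow> real \<Rightarrow> real \<Rightarrow> real" where
  "polar_norm f r t = indicator {0..<1} r * norm (f (of_real r * cis t))"

lemma polar_norm_nonneg [simp]: "0 \<le> polar_norm f r t"
  by (simp add: polar_norm_def)

text \<open>On the strip [0,1) x R the polar map is continuous with values in the disc, where f is
  continuous; off the strip the function is zero.\<close>

lemma measurable_polar_norm:
  assumes "continuous_on (ball 0 1) f"
  shows "(\<lambda>(r, t). polar_norm f r t) \<in> borel_measurable (lborel \<Otimes>\<^sub>M lborel)"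
proof -
  have "(\<lambda>x. indicator ({0..<1} \<times> UNIV) x *\<^sub>R norm (f (of_real (fst x) * cis (snd x)))) \<in> borel_measurable borel"
  proof (rule borel_measurable_continuous_on_indicator)
    have "{0..<1::real} \<times> (UNIV :: real set) \<in> sets (borel \<Otimes>\<^sub>M borel)"
      by (intro pair_measureI) auto
    then show "{0..<1::real} \<times> (UNIV :: real set) \<in> sets borel"
      unfolding borel_prod .
    show "continuous_on ({0..<1} \<times> UNIV) (\<lambda>x::real \<times> real. norm (f (of_real (fst x) * cis (snd x))))"
      by (intro continuous_on_norm continuous_on_compose2[OF assms] continuous_intros)
         (auto simp: norm_mult)
  qed
  moreover have "(\<lambda>(r, t). polar_norm f r t) =
      (\<lambda>x. indicator ({0..<1} \<times> UNIV) x *\<^sub>R norm (f (of_real (fst x) * cis (snd x))))"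
    by (auto simp: polar_norm_def fun_eq_iff indicator_def)
  ultimately show ?thesis
    by (simp add: measurable_cong_sets[OF sets_pair_measure_cong[OF sets_lborel sets_lborel] refl] borel_prod)
qed

lemma radial_integral_eq_polar_norm:
  assumes "0 < p"
  shows "radial_integral p f t = (\<integral>\<^sup>+r. ennreal_powr (ennreal (polar_norm f r t)) p \<partial>lborel)"
  unfolding radial_integral_def
proof (intro nn_integral_cong)
  fix r
  show "ennreal (norm (f (of_real r * cis t)) powr p) * indicator {0..<1} r = ennreal_powr (ennreal (polar_norm f r t)) p"
    by (cases "r \<in> {0..<1}") (simp_all add: polar_norm_def ennreal_powr_ennreal)
qed

lemma measurable_radial_integral:
  assumes "continuous_on (ball 0 1) f" "0 < p"
  shows "radial_integral p f \<in> borel_measurable lborel"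
proof -
  have [measurable]: "(\<lambda>(t, r). polar_norm f r t) \<in> borel_measurable (lborel \<Otimes>\<^sub>M lborel)"
    using measurable_pair_swap[OF measurable_polar_norm[OF assms(1)]] by (simp add: case_prod_unfold)
  have "(\<lambda>t. \<integral>\<^sup>+r. ennreal_powr (ennreal (polar_norm f r t)) p \<partial>lborel) \<in> borel_measurable lborel"
    by measurable
  then show ?thesis by (simp add: radial_integral_eq_polar_norm[OF assms(2), abs_def])
qed

section \<open>Lacunary power series in the disc\<close>

text \<open>With the ratio l fixed, the constants below can be written explicitly in p and l, before
  any coefficients are chosen.\<close>

locale gap_exponents =
  fixes n :: "nat \<Rightarrow> nat" and l :: real
  assumes l: "1 < l" and n_pos: "\<And>k. 0 < n k" and n_step: "\<And>k. l * real (n k) \<le> real (n (Suc k))"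
begin

lemma strict_mono_n: "strict_mono n"
proof (rule strict_mono_Suc_iff[THEN iffD2], intro allI)
  fix k
  have "1 * real (n k) < l * real (n k)" using l n_pos[of k] by (intro mult_strict_right_mono) auto
  then have "real (n k) < real (n (Suc k))" using n_step[of k] by simp
  then show "n k < n (Suc k)" by simp
qed

text \<open>Convergence at a point s with r < s < 1 bounds the terms there, so at r they are
  dominated by a geometric series of ratio r/s.\<close>

lemma summable_norm_gap_series:
  assumes "converges_in_disc n \<alpha>" "0 \<le> r" "r < 1"
  shows "summable (\<lambda>k. norm (\<alpha> k) * r ^ n k)"
proof -
  define s where "s = (1 + r) / 2"
  have s: "0 < s" "s < 1" "r < s" using assms by (auto simp: s_def)
  have "summable (\<lambda>k. \<alpha> k * of_real s ^ n k)"
    using assms(1) s by (auto simp: converges_in_disc_def)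
  then have "Bseq (\<lambda>k. \<alpha> k * of_real s ^ n k)"
    by (intro convergent_imp_Bseq convergentI) (rule summable_LIMSEQ_zero)
  then obtain M where M: "\<And>k. norm (\<alpha> k * of_real s ^ n k) \<le> M" and M0: "0 < M"
    unfolding Bseq_def by auto
  show ?thesis
  proof (rule summable_comparison_test')
    show "summable (\<lambda>k. M * (r / s) ^ k)"
      using assms s by (intro summable_mult summable_geometric) auto
    fix k :: nat
    have "norm (\<alpha> k) * r ^ n k = norm (\<alpha> k * of_real s ^ n k) * (r / s) ^ n k"
      using s by (simp add: norm_mult norm_power power_divide)
    also have "\<dots> \<le> M * (r / s) ^ k"
      by (intro mult_mono power_decreasing M strict_mono_imp_increasing strict_mono_n) (use assms s M0 in auto)
    finally show "norm (norm (\<alpha> k) * r ^ n k) \<le> M * (r / s) ^ k"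
      using assms by simp
  qed
qed

lemma holomorphic_gap_series:
  assumes "converges_in_disc n \<alpha>"
  shows "gap_series n \<alpha> holomorphic_on ball 0 1"
proof (rule holomorphic_uniform_sequence)
  show "(\<lambda>z. \<Sum>k<N. \<alpha> k * z ^ n k) holomorphic_on ball 0 1" for N
    by (intro holomorphic_intros)
  fix x :: complex assume x: "x \<in> ball 0 1"
  define d where "d = (1 - norm x) / 2"
  have d: "0 < d" using x by (simp add: d_def)
  have norm_le: "norm z \<le> norm x + d" if "z \<in> cball x d" for z
    using that norm_triangle_sub[of z x] by (simp add: dist_norm norm_minus_commute)
  have lt: "norm x + d < 1" using x by (simp add: d_def field_simps)
  have "uniform_limit (cball x d) (\<lambda>N z. \<Sum>k<N. \<alpha> k * z ^ n k) (\<lambda>z. \<Sum>k. \<alpha> k * z ^ n k) sequentially"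
  proof (rule Weierstrass_m_test)
    show "summable (\<lambda>k. norm (\<alpha> k) * (norm x + d) ^ n k)"
      using assms lt d by (intro summable_norm_gap_series) auto
    show "norm (\<alpha> k * z ^ n k) \<le> norm (\<alpha> k) * (norm x + d) ^ n k" if "z \<in> cball x d" for k z
      using norm_le[OF that] by (auto simp: norm_mult norm_power intro!: mult_left_mono power_mono)
  qed
  moreover have "cball x d \<subseteq> ball 0 1"
    using norm_le lt by (fastforce simp: dist_norm)
  ultimately show "\<exists>d>0. cball x d \<subseteq> ball 0 1 \<and>
      uniform_limit (cball x d) (\<lambda>N z. \<Sum>k<N. \<alpha> k * z ^ n k) (gap_series n \<alpha>) sequentially"
    using d by (auto simp: gap_series_def[abs_def])
qed auto

text \<open>\<alpha>_k r^(n_k) is the Fourier coefficient of index n_k of the function t \<mapsto>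
  f(r e^(it)), hence bounded by the mean of its modulus.\<close>

lemma norm_coeff_le_circle_integral:
  assumes conv: "converges_in_disc n \<alpha>" and r: "0 \<le> r" "r < 1"
  shows "ennreal (2 * pi * norm (\<alpha> k) * r ^ n k) \<le>
    (\<integral>\<^sup>+t \<in> {0..2 * pi}. ennreal (norm (gap_series n \<alpha> (of_real r * cis t))) \<partial>lborel)"
proof -
  define g where "g = (\<lambda>j t. indicator {0..2 * pi} t *\<^sub>R (\<alpha> j * (of_real r * cis t) ^ n j * cis (- (real (n k) * t))))"
  have g_alt: "g j t = (\<alpha> j * of_real r ^ n j) * (indicator {0..2 * pi} t *\<^sub>R cis (of_int (int (n j) - int (n k)) * t))" for j t
    by (simp add: g_def power_mult_distrib Complex.DeMoivre cis_mult algebra_simps)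
  have int: "has_bochner_integral lborel (g j) (if j = k then 2 * pi * \<alpha> k * of_real r ^ n k else 0)" for j
  proof -
    have "has_bochner_integral lborel (g j)
       ((\<alpha> j * of_real r ^ n j) * of_real (if int (n j) - int (n k) = 0 then 2 * pi else 0))"
      unfolding g_alt by (intro has_bochner_integral_mult_right has_bochner_integral_cis)
    \<comment> \<open>The exponents are distinct, so orthogonality leaves only the index j =
      k.\<close>
    moreover have "int (n j) - int (n k) = 0 \<longleftrightarrow> j = k"
      using strict_mono_eq[OF strict_mono_n, of j k] by auto
    ultimately show ?thesis by (simp add: ac_simps split: if_splits)
  qed
  have norm_g: "norm (g j t) = indicator {0..2 * pi} t * (norm (\<alpha> j) * r ^ n j)" for j t
    using r by (simp add: g_def norm_mult norm_power)
  have summ: "summable (\<lambda>j. norm (\<alpha> j) * r ^ n j)"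
    using conv r by (rule summable_norm_gap_series)
  have ig: "integrable lborel (g j)" for j using int by (simp add: has_bochner_integral_iff)
  \<comment> \<open>Absolute convergence on the circle of radius r justifies integrating term by
    term.\<close>
  have s1: "AE t in lborel. summable (\<lambda>j. norm (g j t))"
    unfolding norm_g using summ by (intro AE_I2 summable_mult)
  have s2: "summable (\<lambda>j. \<integral>t. norm (g j t) \<partial>lborel)"
    unfolding norm_g using summ by (simp add: summable_mult)
  have "(\<integral>t. (\<Sum>j. g j t) \<partial>lborel) = (\<Sum>j. integral\<^sup>L lborel (g j))"
    by (rule integral_suminf[OF ig s1 s2])
  also have "\<dots> = (\<Sum>j. if j = k then 2 * pi * \<alpha> k * of_real r ^ n k else 0)"
    using int by (simp add: has_bochner_integral_iff)
  also have "\<dots> = 2 * pi * \<alpha> k * of_real r ^ n k"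
    using sums_single[of k "\<lambda>_. 2 * pi * \<alpha> k * of_real r ^ n k"] by (simp add: sums_iff)
  finally have "ennreal (2 * pi * norm (\<alpha> k) * r ^ n k) = ennreal (norm (\<integral>t. (\<Sum>j. g j t) \<partial>lborel))"
    using r by (simp add: norm_mult norm_power)
  also have "\<dots> \<le> (\<integral>\<^sup>+t. norm (\<Sum>j. g j t) \<partial>lborel)"
    by (intro integral_norm_bound_ennreal integrable_suminf[OF ig s1 s2])
  also have "\<dots> = (\<integral>\<^sup>+t \<in> {0..2 * pi}. ennreal (norm (gap_series n \<alpha> (of_real r * cis t))) \<partial>lborel)"
  proof (intro nn_integral_cong)
    fix t
    have "summable (\<lambda>j. \<alpha> j * (of_real r * cis t) ^ n j)"
      using conv r by (auto simp: converges_in_disc_def norm_mult)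
    then have "(\<Sum>j. g j t) = indicator {0..2 * pi} t *\<^sub>R (gap_series n \<alpha> (of_real r * cis t) * cis (- (real (n k) * t)))"
      unfolding g_def gap_series_def
      by (subst suminf_mult2, simp, subst suminf_scaleR_right) (auto intro: summable_mult2)
    then show "ennreal (norm (\<Sum>j. g j t)) = ennreal (norm (gap_series n \<alpha> (of_real r * cis t))) * indicator {0..2 * pi} t"
      by (auto simp: norm_mult indicator_def)
  qed
  finally show ?thesis .
qed

section \<open>Weighted lacunary sums\<close>

text \<open>Factor out (1 - r)^(-d) and put x = n_k (1 - r), y_k = x^d; the y_k grow at least by the
  ratio l^d. Since 2d \<le> 1, y_k^2 is at most max(1, x), and x r^(n_k) \<le> 1, so y_k r^(n_k) is
  at most min(y_k, 1/y_k).\<close>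

lemma gap_weight_sum_le:
  assumes d: "0 < d" "d \<le> 1/2" and r: "0 \<le> r" "r < 1"
  shows "(\<Sum>k<K. real (n k) powr d * r ^ n k) \<le> 2 / (1 - 1 / l powr d) * (1 - r) powr (-d)"
proof -
  define y where "y = (\<lambda>k. (real (n k) * (1 - r)) powr d)"
  have y: "0 < y k" for k using n_pos[of k] r by (simp add: y_def)
  have "real (n k) powr d * r ^ n k \<le> (1 - r) powr (-d) * min (y k) (1 / y k)" for k
  proof -
    define x where "x = real (n k) * (1 - r)"
    have x: "0 < x" using n_pos[of k] r by (simp add: x_def)
    have "y k * r ^ n k \<le> y k" using y[of k] r by (simp add: power_le_one mult_left_le)
    moreover have "y k * r ^ n k \<le> 1 / y k"
    proof -
      have "y k * y k = x powr (2 * d)" by (simp add: y_def x_def flip: powr_add)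
      also have "\<dots> \<le> max 1 x"
      proof (cases "x \<le> 1")
        case True
        then show ?thesis using x d powr_mono2[of "2 * d" x 1] by simp
      next
        case False
        then have "x powr (2 * d) \<le> x powr 1" using d by (intro powr_mono) auto
        then show ?thesis using False by simp
      qed
      finally have "y k * y k * r ^ n k \<le> max 1 x * r ^ n k" using r by (intro mult_right_mono) auto
      also have "\<dots> \<le> 1"
        using of_nat_mult_power_le[of r "n k"] r by (auto simp: x_def max_def power_le_one)
      finally show ?thesis using y[of k] by (simp add: pos_le_divide_eq ac_simps)
    qed
    ultimately have "y k * r ^ n k \<le> min (y k) (1 / y k)" by simp
    then have "(1 - r) powr (-d) * (y k * r ^ n k) \<le> (1 - r) powr (-d) * min (y k) (1 / y k)"
      by (intro mult_left_mono) auto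
    moreover have "(1 - r) powr (-d) * y k = real (n k) powr d"
      using r by (simp add: y_def powr_mult powr_minus)
    ultimately show ?thesis by (simp flip: mult.assoc)
  qed
  then have "(\<Sum>k<K. real (n k) powr d * r ^ n k) \<le> (1 - r) powr (-d) * (\<Sum>k<K. min (y k) (1 / y k))"
    unfolding sum_distrib_left by (intro sum_mono)
  also have "\<dots> \<le> (1 - r) powr (-d) * (2 / (1 - 1 / l powr d))"
  proof (intro mult_left_mono sum_min_inverse_geometric_le y)
    show "1 < l powr d" using l d by (simp add: gr_one_powr)
    show "l powr d * y k \<le> y (Suc k)" for k
    proof -
      have "l powr d * y k = (l * real (n k) * (1 - r)) powr d"
        using l r by (simp add: y_def powr_mult)
      also have "\<dots> \<le> y (Suc k)"
        unfolding y_def using n_step[of k] l r d by (intro powr_mono2 mult_right_mono) auto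
      finally show ?thesis .
    qed
  qed auto
  finally show ?thesis by (simp add: mult.commute)
qed

text \<open>Jensen for a_k r^(n_k) = w_k b_k with b_k = a_k n_k^(-d). The choice d = 1/(2p)
  satisfies d \<le> 1/2, as the weight estimate requires, and d(p - 1) \<le> 1/2, as the later
  integration in r requires.\<close>

lemma gap_sum_powr_le:
  assumes p: "1 \<le> p" and r: "0 \<le> r" "r < 1" and a: "\<And>k. 0 \<le> a k"
  defines "d \<equiv> 1 / (2 * p)"
  shows "(\<Sum>k<K. a k * r ^ n k) powr p \<le>
    (2 / (1 - 1 / l powr d)) powr (p - 1) * (1 - r) powr (- (d * (p - 1))) *
      (\<Sum>k<K. a k powr p * real (n k) powr (- (d * (p - 1))) * r ^ n k)"
proof -
  define w where "w = (\<lambda>k. real (n k) powr d * r ^ n k)"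
  define b where "b = (\<lambda>k. a k * real (n k) powr (-d))"
  have d: "0 < d" "d \<le> 1/2" using p by (auto simp: d_def)
  have w: "0 \<le> w k" for k using r by (simp add: w_def)
  have ld: "1 < l powr d" using l d by (simp add: gr_one_powr)
  have "(\<Sum>k<K. a k * r ^ n k) powr p = (\<Sum>k<K. w k * b k) powr p"
    using n_pos by (intro arg_cong2[where f = "(powr)"] sum.cong) (auto simp: w_def b_def powr_minus less_imp_neq[symmetric])
  also have "\<dots> \<le> (\<Sum>k<K. w k) powr (p - 1) * (\<Sum>k<K. w k * b k powr p)"
    using p w a by (intro jensen_powr_sum) (auto simp: b_def)
  also have "\<dots> \<le> (2 / (1 - 1 / l powr d) * (1 - r) powr (-d)) powr (p - 1) * (\<Sum>k<K. w k * b k powr p)"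
    unfolding w_def using p w d r gap_weight_sum_le[OF d r]
    by (intro mult_right_mono powr_mono2 sum_nonneg) auto
  also have "(2 / (1 - 1 / l powr d) * (1 - r) powr (-d)) powr (p - 1)
      = (2 / (1 - 1 / l powr d)) powr (p - 1) * (1 - r) powr (- (d * (p - 1)))"
    using ld r by (subst powr_mult) (auto simp: powr_powr)
  also have "(\<Sum>k<K. w k * b k powr p) = (\<Sum>k<K. a k powr p * real (n k) powr (- (d * (p - 1))) * r ^ n k)"
  proof (intro sum.cong refl)
    fix k
    have "real (n k) powr d * (real (n k) powr (-d)) powr p = real (n k) powr (- (d * (p - 1)))"
      by (simp add: powr_powr algebra_simps flip: powr_add)
    then show "w k * b k powr p = a k powr p * real (n k) powr (- (d * (p - 1))) * r ^ n k"
      using a by (simp add: w_def b_def powr_mult ac_simps)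
  qed
  finally show ?thesis .
qed

end

section \<open>Comparison of \<open>rho\<close> with bounds on the radial integral\<close>

text \<open>The measure dt/(2 pi) on [0, 2 pi] has mass one, so a bound uniform in t passes to every
  q-mean without loss.\<close>

lemma rho_le:
  assumes "continuous_on (ball 0 1) f" "1 \<le> p" "1 \<le> q" and B: "\<And>t. radial_integral p f t \<le> B"
  shows "rho p q f \<le> ennreal_powr B (1 / p)"
proof (cases q)
  case top
  have [measurable]: "radial_integral p f \<in> borel_measurable lborel"
    using assms by (intro measurable_radial_integral) auto
  have "(\<lambda>t. ennreal_powr (radial_integral p f t) (1 / p)) \<in> borel_measurable (restrict_space lborel {0..<2 * pi})"
    by (intro measurable_restrict_space1) measurable
  then show ?thesis
    using assms unfolding rho_def if_P[OF top]
    by (intro esssup_I AE_I2 ennreal_powr_mono) auto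
next
  case (real s)
  then have s: "1 \<le> s" using assms(3) by (simp flip: ennreal_1)
  have "ennreal (1 / (2 * pi)) * (\<integral>\<^sup>+t \<in> {0..2 * pi}. ennreal_powr (radial_integral p f t) (s / p) \<partial>lborel)
     \<le> ennreal (1 / (2 * pi)) * (\<integral>\<^sup>+t \<in> {0..2 * pi}. ennreal_powr B (s / p) \<partial>lborel)"
    using assms s by (intro mult_left_mono nn_integral_mono mult_right_mono ennreal_powr_mono B) auto
  also have "\<dots> = ennreal_powr B (s / p) * (ennreal (1 / (2 * pi)) * ennreal (2 * pi))"
    by (simp add: nn_integral_cmult_indicator ac_simps)
  also have "\<dots> = ennreal_powr B (s / p)"
    by (simp flip: ennreal_mult)
  finally have "ennreal_powr (ennreal (1 / (2 * pi)) *
      (\<integral>\<^sup>+t \<in> {0..2 * pi}. ennreal_powr (radial_integral p f t) (s / p) \<partial>lborel)) (1 / s)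
      \<le> ennreal_powr (ennreal_powr B (s / p)) (1 / s)"
    using s by (intro ennreal_powr_mono) auto
  then show ?thesis using real s by (simp add: rho_def ennreal_powr_powr)
qed

text \<open>Monotonicity of power means on the circle, which reduces lower bounds for every q to the
  case q = 1.\<close>

lemma circle_mean_le_rho:
  assumes "continuous_on (ball 0 1) f" "1 \<le> p" "1 \<le> q"
  shows "ennreal (1 / (2 * pi)) * (\<integral>\<^sup>+t \<in> {0..2 * pi}. ennreal_powr (radial_integral p f t) (1 / p) \<partial>lborel)
     \<le> rho p q f"
proof -
  define Y where "Y = (\<lambda>t. ennreal_powr (radial_integral p f t) (1 / p))"
  have [measurable]: "radial_integral p f \<in> borel_measurable lborel"
    using assms by (intro measurable_radial_integral) auto
  have Y [measurable]: "Y \<in> borel_measurable lborel" unfolding Y_def by measurable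
  show ?thesis
  proof (cases q)
    case top
    define E where "E = rho p q f"
    have "E = esssup (restrict_space lborel {0..<2 * pi}) Y"
      using top by (simp add: E_def rho_def Y_def)
    then have "AE t in restrict_space lborel {0..<2 * pi}. Y t \<le> E"
      using esssup_AE by simp
    then have "AE t in lborel. t \<in> {0..<2 * pi} \<longrightarrow> Y t \<le> E"
      by (subst (asm) AE_restrict_space_iff) auto
    \<comment> \<open>The essential supremum is taken over [0, 2 pi) and the mean over [0, 2 pi];
      the endpoint is a null set.\<close>
    moreover have "AE t in lborel. t \<noteq> 2 * pi" by (rule AE_lborel_singleton)
    ultimately have "AE t in lborel. Y t * indicator {0..2 * pi} t \<le> E * indicator {0..2 * pi} t"
      by eventually_elim (auto simp: indicator_def)
    then have "(\<integral>\<^sup>+t \<in> {0..2 * pi}. Y t \<partial>lborel) \<le> (\<integral>\<^sup>+t \<in> {0..2 * pi}. E \<partial>lborel)"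
      by (rule nn_integral_mono_AE)
    then have "ennreal (1 / (2 * pi)) * (\<integral>\<^sup>+t \<in> {0..2 * pi}. Y t \<partial>lborel) \<le> ennreal (1 / (2 * pi)) * (E * ennreal (2 * pi))"
      by (intro mult_left_mono) (auto simp: nn_integral_cmult_indicator)
    also have "\<dots> = E * (ennreal (1 / (2 * pi)) * ennreal (2 * pi))" by (simp only: ac_simps)
    also have "\<dots> = E" by (simp flip: ennreal_mult)
    finally show ?thesis by (simp add: E_def Y_def)
  next
    case (real s)
    then have s: "1 \<le> s" using assms(3) by (simp flip: ennreal_1)
    \<comment> \<open>Normalised Lebesgue measure on the circle; \<open>holder_dual\<close> is
      applied to it with h = 1 and exponent s.\<close>
    define M where "M = density lborel (\<lambda>t. ennreal (1 / (2 * pi)) * indicator {0..2 * pi} t)"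
    have M: "(\<integral>\<^sup>+t. G t \<partial>M) = ennreal (1 / (2 * pi)) * (\<integral>\<^sup>+t \<in> {0..2 * pi}. G t \<partial>lborel)"
      if [measurable]: "G \<in> borel_measurable lborel" for G
      unfolding M_def by (subst nn_integral_density) (auto simp: ac_simps nn_integral_cmult[symmetric])
    have YM: "Y \<in> borel_measurable M" using Y by (simp add: M_def)
    have one: "(\<integral>\<^sup>+t. ennreal (1 powr s) \<partial>M) \<le> 1"
      by (subst M) (auto simp flip: ennreal_mult)
    have "(\<integral>\<^sup>+t. Y t * ennreal (1 powr (s - 1)) \<partial>M) \<le> ennreal_powr (\<integral>\<^sup>+t. ennreal_powr (Y t) s \<partial>M) (1 / s)"
      using one by (intro holder_dual s YM) auto
    then have "(\<integral>\<^sup>+t. Y t \<partial>M) \<le> ennreal_powr (\<integral>\<^sup>+t. ennreal_powr (Y t) s \<partial>M) (1 / s)" by simp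
    then show ?thesis
      using real s by (simp add: M rho_def Y_def ennreal_powr_powr)
  qed
qed

section \<open>Facts on blocks used in the lower bound\<close>

text \<open>At most one term is nonzero at each point. Where there is none, both sides vanish even
  for \<open>s = 0\<close>, since \<open>0 powr 0 = 0\<close>; this covers the exponent
  \<open>p - 1\<close> at \<open>p = 1\<close>.\<close>

lemma powr_sum_indicator_disjoint:
  fixes c :: "'i \<Rightarrow> real"
  assumes "finite A" "disjoint_family_on I A"
  shows "(\<Sum>i\<in>A. c i * indicator (I i) x) powr s = (\<Sum>i\<in>A. c i powr s * indicator (I i) x)"
proof (cases "\<exists>i\<in>A. x \<in> I i")
  case True
  then obtain i where i: "i \<in> A" "x \<in> I i" by blast
  have "indicator (I j) x = (if j = i then 1 else 0 :: real)" if "j \<in> A" for j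
    using i that assms(2) by (auto simp: disjoint_family_on_def indicator_def)
  then have "(\<Sum>j\<in>A. b j * indicator (I j) x) = (\<Sum>j\<in>A. if j = i then b j else 0)" for b :: "'i \<Rightarrow> real"
    by (intro sum.cong) auto
  then have "(\<Sum>j\<in>A. b j * indicator (I j) x) = b i" for b :: "'i \<Rightarrow> real"
    using i assms(1) by simp
  then show ?thesis by simp
qed auto

text \<open>Bernoulli: (1 - 1/(2m))^m is at least 1 - m/(2m).\<close>

lemma half_le_power:
  assumes "0 < m" "1 - 1 / (2 * real m) \<le> r"
  shows "1 / 2 \<le> r ^ m"
proof -
  have "1 / 2 = 1 + real m * (- (1 / (2 * real m)))" using assms by simp
  also have "\<dots> \<le> (1 + (- (1 / (2 * real m)))) ^ m"
    using assms by (intro Bernoulli_inequality) (simp add: field_simps)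
  also have "\<dots> \<le> r ^ m"
    using assms by (intro power_mono) (auto simp: field_simps)
  finally show ?thesis .
qed

section \<open>Upper bound by the coefficient sum\<close>

context gap_exponents
begin

text \<open>Provides convergence in the disc from the coefficient condition alone. In
  \<open>gap_sum_powr_le\<close> at fixed r, the negative power of n_k is at most 1 and r^(n_k)
  \<le> 1/(n_k (1 - r)), so the partial sums are bounded by a multiple of the given series.\<close>

lemma summable_norm_gap_series_of_coeff:
  assumes p: "1 \<le> p" and S: "summable (\<lambda>k. norm (\<alpha> k) powr p / real (n k))"
    and r: "0 \<le> r" "r < 1"
  shows "summable (\<lambda>k. norm (\<alpha> k) * r ^ n k)"
proof -
  define d where "d = 1 / (2 * p)"
  define c where "c = (2 / (1 - 1 / l powr d)) powr (p - 1) * (1 - r) powr (- (d * (p - 1)))"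
  have d: "0 \<le> d * (p - 1)" using p by (simp add: d_def)
  define B where "B = c * (1 / (1 - r) * (\<Sum>k. norm (\<alpha> k) powr p / real (n k)))"
  have c: "0 \<le> c" by (simp add: c_def)
  have "(\<Sum>k<K. norm (\<alpha> k) * r ^ n k) \<le> B powr (1 / p)" for K
  proof -
    have "(\<Sum>k<K. norm (\<alpha> k) * r ^ n k) powr p \<le>
        c * (\<Sum>k<K. norm (\<alpha> k) powr p * real (n k) powr (- (d * (p - 1))) * r ^ n k)"
      unfolding c_def d_def using p r by (intro gap_sum_powr_le) auto
    also have "\<dots> \<le> c * (\<Sum>k<K. 1 / (1 - r) * (norm (\<alpha> k) powr p / real (n k)))"
    proof (intro mult_left_mono sum_mono c)
      fix k
      have "real (n k) powr (- (d * (p - 1))) * r ^ n k \<le> 1 * (1 / (real (n k) * (1 - r)))"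
      proof (intro mult_mono)
        show "real (n k) powr (- (d * (p - 1))) \<le> 1"
          using powr_mono[of "- (d * (p - 1))" 0 "real (n k)"] d n_pos[of k] by simp
        show "r ^ n k \<le> 1 / (real (n k) * (1 - r))"
          using of_nat_mult_power_le[of r "n k"] r n_pos[of k] by (simp add: pos_le_divide_eq mult.commute)
      qed (use r in auto)
      then have "norm (\<alpha> k) powr p * (real (n k) powr (- (d * (p - 1))) * r ^ n k)
          \<le> norm (\<alpha> k) powr p * (1 * (1 / (real (n k) * (1 - r))))"
        by (intro mult_left_mono) auto
      then show "norm (\<alpha> k) powr p * real (n k) powr (- (d * (p - 1))) * r ^ n k
          \<le> 1 / (1 - r) * (norm (\<alpha> k) powr p / real (n k))"
        by (simp add: mult.assoc) (simp add: mult.commute)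
    qed
    also have "\<dots> \<le> B"
      unfolding B_def sum_distrib_left[symmetric] using r c
      by (intro mult_left_mono sum_le_suminf S) auto
    finally have "((\<Sum>k<K. norm (\<alpha> k) * r ^ n k) powr p) powr (1 / p) \<le> B powr (1 / p)"
      using p by (intro powr_mono2) auto
    then show ?thesis using p r by (simp add: powr_powr sum_nonneg)
  qed
  then show ?thesis using r by (intro summableI_nonneg_bounded) auto
qed

text \<open>On the ray of angle t, |f| is at most the sum of |\<alpha>_k| r^(n_k), which does not
  depend on t. Its p-th power is estimated by \<open>gap_sum_powr_le\<close> and integrated term by
  term.\<close>

lemma radial_integral_gap_series_le:
  assumes p: "1 \<le> p" and summ: "\<And>r. 0 \<le> r \<Longrightarrow> r < 1 \<Longrightarrow> summable (\<lambda>k. norm (\<alpha> k) * r ^ n k)"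
  shows "radial_integral p (gap_series n \<alpha>) t \<le>
    ennreal ((2 / (1 - 1 / l powr (1 / (2 * p)))) powr (p - 1) * 3) * (\<Sum>k. ennreal (norm (\<alpha> k) powr p / real (n k)))"
proof -
  define d where "d = 1 / (2 * p)"
  define e where "e = d * (p - 1)"
  have e: "0 \<le> e" "e \<le> 1/2" using p by (auto simp: e_def d_def field_simps)
  define c where "c = (2 / (1 - 1 / l powr d)) powr (p - 1)"
  have c: "0 \<le> c" by (simp add: c_def)
  define a where "a = (\<lambda>k. norm (\<alpha> k) powr p * real (n k) powr (-e))"
  have a: "0 \<le> a k" for k by (simp add: a_def)
  have pw: "ennreal (norm (gap_series n \<alpha> (of_real r * cis t)) powr p) * indicator {0..<1} r
     \<le> ennreal c * (\<Sum>k. ennreal (a k) * (ennreal ((1 - r) powr (-e) * r ^ n k) * indicator {0..<1} r))" for r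
  proof (cases "r \<in> {0..<1}")
    case True
    then have r: "0 \<le> r" "r < 1" by auto
    let ?s = "\<lambda>K. \<Sum>k<K. norm (\<alpha> k) * r ^ n k"
    have "norm (gap_series n \<alpha> (of_real r * cis t)) \<le> (\<Sum>k. norm (\<alpha> k) * r ^ n k)"
      using summable_norm[of "\<lambda>k. \<alpha> k * (of_real r * cis t) ^ n k"] summ[OF r] r
      by (simp add: gap_series_def norm_mult norm_power)
    then have "norm (gap_series n \<alpha> (of_real r * cis t)) powr p \<le> (\<Sum>k. norm (\<alpha> k) * r ^ n k) powr p"
      using p by (intro powr_mono2) auto
    then have "ennreal (norm (gap_series n \<alpha> (of_real r * cis t)) powr p) \<le> ennreal ((\<Sum>k. norm (\<alpha> k) * r ^ n k) powr p)"
      by (rule ennreal_leI)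
    also have "\<dots> \<le> ennreal c * (\<Sum>k. ennreal (a k) * ennreal ((1 - r) powr (-e) * r ^ n k))"
    \<comment> \<open>The finite estimate passes to the limit in K. The right side is a series in
      \<open>ennreal\<close>, so it may be infinite here.\<close>
    proof (rule LIMSEQ_le_const2)
      show "(\<lambda>K. ennreal (?s K powr p)) \<longlonglongrightarrow> ennreal ((\<Sum>k. norm (\<alpha> k) * r ^ n k) powr p)"
        using summable_LIMSEQ[OF summ[OF r]] p r
        by (intro tendsto_ennrealI tendsto_powr') (auto intro!: always_eventually sum_nonneg)
      have "ennreal (?s K powr p) \<le> ennreal c * (\<Sum>k. ennreal (a k) * ennreal ((1 - r) powr (-e) * r ^ n k))" for K
      proof -
        have "?s K powr p \<le> c * (1 - r) powr (-e) *
            (\<Sum>k<K. norm (\<alpha> k) powr p * real (n k) powr (-e) * r ^ n k)"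
          unfolding c_def d_def e_def using p r by (intro gap_sum_powr_le) auto
        also have "\<dots> = c * (\<Sum>k<K. a k * ((1 - r) powr (-e) * r ^ n k))"
          by (simp add: a_def sum_distrib_left ac_simps)
        finally have "ennreal (?s K powr p) \<le> ennreal (c * (\<Sum>k<K. a k * ((1 - r) powr (-e) * r ^ n k)))"
          by (rule ennreal_leI)
        also have "\<dots> = ennreal c * (\<Sum>k<K. ennreal (a k) * ennreal ((1 - r) powr (-e) * r ^ n k))"
          using c a r by (simp add: ennreal_mult sum_nonneg flip: sum_ennreal)
        also have "\<dots> \<le> ennreal c * (\<Sum>k. ennreal (a k) * ennreal ((1 - r) powr (-e) * r ^ n k))"
          by (intro mult_left_mono sum_le_suminf) auto
        finally show ?thesis .
      qed
      then show "\<exists>N. \<forall>K\<ge>N. ennreal (?s K powr p) \<le> ennreal c * (\<Sum>k. ennreal (a k) * ennreal ((1 - r) powr (-e) * r ^ n k))"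
        by blast
    qed
    finally show ?thesis using True by simp
  qed simp
  have "radial_integral p (gap_series n \<alpha>) t \<le>
     (\<integral>\<^sup>+r. ennreal c * (\<Sum>k. ennreal (a k) * (ennreal ((1 - r) powr (-e) * r ^ n k) * indicator {0..<1} r)) \<partial>lborel)"
    unfolding radial_integral_def by (intro nn_integral_mono pw)
  also have "\<dots> = ennreal c * (\<Sum>k. ennreal (a k) * (\<integral>\<^sup>+r \<in> {0..<1}. ennreal ((1 - r) powr (-e) * r ^ n k) \<partial>lborel))"
    by (simp add: nn_integral_cmult nn_integral_suminf)
  also have "\<dots> \<le> ennreal c * (\<Sum>k. ennreal (a k) * ennreal (3 * real (n k) powr (e - 1)))"
    by (intro mult_left_mono suminf_le nn_integral_one_minus_powr_power_le e n_pos) auto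
  also have "(\<lambda>k. ennreal (a k) * ennreal (3 * real (n k) powr (e - 1))) = (\<lambda>k. ennreal 3 * ennreal (norm (\<alpha> k) powr p / real (n k)))"
  proof
    fix k
    \<comment> \<open>The exponent -e from Jensen and e - 1 from the integral add up to -1, which
      produces the weight 1/n_k.\<close>
    have "real (n k) powr (-e) * real (n k) powr (e - 1) = 1 / real (n k)"
      using n_pos[of k] powr_add[of "real (n k)" "-e" "e - 1"] by (simp add: powr_minus_divide)
    moreover have "a k * (3 * real (n k) powr (e - 1)) =
        3 * norm (\<alpha> k) powr p * (real (n k) powr (-e) * real (n k) powr (e - 1))"
      by (simp add: a_def)
    ultimately have eq: "a k * (3 * real (n k) powr (e - 1)) = 3 * (norm (\<alpha> k) powr p / real (n k))"
      by (simp only:) simp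
    have "ennreal (a k) * ennreal (3 * real (n k) powr (e - 1)) = ennreal (a k * (3 * real (n k) powr (e - 1)))"
      using a by (intro ennreal_mult[symmetric]) auto
    also have "\<dots> = ennreal 3 * ennreal (norm (\<alpha> k) powr p / real (n k))"
      unfolding eq by (intro ennreal_mult) auto
    finally show "ennreal (a k) * ennreal (3 * real (n k) powr (e - 1)) = ennreal 3 * ennreal (norm (\<alpha> k) powr p / real (n k))" .
  qed
  also have "ennreal c * (\<Sum>k. ennreal 3 * ennreal (norm (\<alpha> k) powr p / real (n k)))
      = ennreal (c * 3) * (\<Sum>k. ennreal (norm (\<alpha> k) powr p / real (n k)))"
    using c by (simp only: ennreal_suminf_cmult ennreal_mult mult.assoc)
  finally show ?thesis by (simp add: c_def d_def)
qed

section \<open>Lower bound by duality in the radial variable\<close>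

text \<open>H is the p-th power of the L^p norm of the step function equal to |\<alpha>_k| on the
  k-th block. Pairing |f| with the (p-1)-th power of the normalised step function recovers half of
  that norm after averaging in t, while Hoelder in r bounds the pairing for each t. Finitely many
  blocks keep H finite.\<close>

lemma gap_block_sum_le_circle_mean:
  fixes K :: nat
  assumes conv: "converges_in_disc n \<alpha>" and p: "1 \<le> p"
  defines "H \<equiv> (\<Sum>k<K. norm (\<alpha> k) powr p * (1 / (2 * real (n k)) - 1 / (2 * real (n (Suc k)))))"
  shows "ennreal (H powr (1 / p) / 2) \<le>
    ennreal (1 / (2 * pi)) * (\<integral>\<^sup>+t \<in> {0..2 * pi}. ennreal_powr (radial_integral p (gap_series n \<alpha>) t) (1 / p) \<partial>lborel)"
proof -
  define u where "u = (\<lambda>k. 1 - 1 / (2 * real (n k)))"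
  define I where "I = (\<lambda>k. {u k..<u (Suc k)})"
  have u_less: "u k < u (Suc k)" for k
    using strict_monoD[OF strict_mono_n, of k "Suc k"] n_pos[of k] by (simp add: u_def field_simps)
  have u_mono: "u j \<le> u k" if "j \<le> k" for j k
    using lift_Suc_mono_le[of u] u_less that by (meson less_imp_le)
  have u_bounds: "0 \<le> u k" "u k < 1" for k
    using n_pos[of k] by (auto simp: u_def field_simps)
  have disj: "disjoint_family_on I {..<K}"
  proof -
    have "I j \<inter> I k = {}" if "j < k" for j k
      using u_mono[of "Suc j" k] that by (auto simp: I_def)
    then show ?thesis by (auto simp: disjoint_family_on_def) (metis disjoint_iff linorder_neqE_nat)
  qed
  have I_sub: "I k \<subseteq> {0..<1}" for k using u_bounds[of k] u_bounds[of "Suc k"] by (auto simp: I_def)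
  have I_meas [measurable]: "I k \<in> sets borel" for k by (simp add: I_def)
  have I_em: "emeasure lborel (I k) = ennreal (u (Suc k) - u k)" for k
    using u_less[of k] by (simp add: I_def less_imp_le)
  have H: "H = (\<Sum>k<K. norm (\<alpha> k) powr p * (u (Suc k) - u k))" by (simp add: H_def u_def)
  have "0 \<le> H" unfolding H using u_less by (intro sum_nonneg) (simp add: less_imp_le)
  show ?thesis
  proof (cases "H = 0")
    case False
    with \<open>0 \<le> H\<close> have Hpos: "0 < H" by simp
    \<comment> \<open>N is the L^p norm of the step function; dividing by it gives h unit
      norm.\<close>
    define N where "N = H powr (1 / p)"
    have N: "0 < N" "N powr p = H" using Hpos p by (auto simp: N_def powr_powr)
    define b where "b = (\<lambda>k. norm (\<alpha> k) / N)"
    have b: "0 \<le> b k" for k using N by (simp add: b_def)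
    define h where "h = (\<lambda>r. \<Sum>k<K. b k * indicator (I k) r)"
    have h_powr: "ennreal (h r powr s) = (\<Sum>k<K. ennreal (b k powr s) * indicator (I k) r)" for r s
    proof -
      have "h r powr s = (\<Sum>k<K. b k powr s * indicator (I k) r)"
        unfolding h_def by (intro powr_sum_indicator_disjoint disj) simp
      also have "ennreal \<dots> = (\<Sum>k<K. ennreal (b k powr s * indicator (I k) r))"
        by (intro sum_ennreal[symmetric]) auto
      also have "\<dots> = (\<Sum>k<K. ennreal (b k powr s) * indicator (I k) r)"
        by (intro sum.cong) (auto simp: indicator_def)
      finally show ?thesis .
    qed
    have h [measurable]: "h \<in> borel_measurable borel" unfolding h_def by measurable
    have h0: "0 \<le> h r" for r unfolding h_def using b by (intro sum_nonneg) auto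
    have h1: "(\<integral>\<^sup>+r. ennreal (h r powr p) \<partial>lborel) \<le> 1"
    proof -
      have "(\<integral>\<^sup>+r. ennreal (h r powr p) \<partial>lborel) = (\<Sum>k<K. ennreal (b k powr p) * ennreal (u (Suc k) - u k))"
        unfolding h_powr by (simp add: nn_integral_sum nn_integral_cmult_indicator I_em del: sum_mult_indicator)
      also have "\<dots> = ennreal (\<Sum>k<K. b k powr p * (u (Suc k) - u k))"
        using u_less by (simp add: ennreal_mult less_imp_le flip: sum_ennreal)
      also have "(\<Sum>k<K. b k powr p * (u (Suc k) - u k)) = H / N powr p"
        unfolding H sum_divide_distrib b_def using N(1) by (intro sum.cong) (simp_all add: powr_divide)
      finally show ?thesis using N Hpos by simp
    qed
    define f where "f = gap_series n \<alpha>"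
    have cont: "continuous_on (ball 0 1) f"
      unfolding f_def using holomorphic_gap_series[OF conv] by (rule holomorphic_on_imp_continuous_on)
    note measurable_polar_norm[OF cont, measurable]
    define m where "m = (\<lambda>r. \<integral>\<^sup>+t. ennreal (1 / (2 * pi)) * (ennreal (polar_norm f r t) * indicator {0..2 * pi} t) \<partial>lborel)"
    \<comment> \<open>To the right of 1 - 1/(2 n_k) the factor r^(n_k) is at least 1/2, so the
      circle mean retains half of |\<alpha>_k|.\<close>
    have m_ge: "ennreal (norm (\<alpha> k) / 2) \<le> m r" if "r \<in> I k" for k r
    proof -
      have r: "0 \<le> r" "r < 1" using that I_sub[of k] by auto
      have "1 / 2 \<le> r ^ n k" using n_pos[of k] that by (intro half_le_power) (auto simp: I_def u_def)
      then have "ennreal (norm (\<alpha> k) * (1 / 2)) \<le> ennreal (norm (\<alpha> k) * r ^ n k)"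
        by (intro ennreal_leI mult_left_mono) auto
      also have "\<dots> = ennreal (1 / (2 * pi)) * ennreal (2 * pi * norm (\<alpha> k) * r ^ n k)"
        using r by (simp flip: ennreal_mult)
      also have "\<dots> \<le> ennreal (1 / (2 * pi)) * (\<integral>\<^sup>+t \<in> {0..2 * pi}. ennreal (norm (f (of_real r * cis t))) \<partial>lborel)"
        unfolding f_def by (intro mult_left_mono norm_coeff_le_circle_integral conv r) auto
      also have "\<dots> = ennreal (1 / (2 * pi)) * (\<integral>\<^sup>+t \<in> {0..2 * pi}. ennreal (polar_norm f r t) \<partial>lborel)"
        using r by (simp add: polar_norm_def)
      also have "\<dots> = m r" unfolding m_def by (simp add: nn_integral_cmult)
      finally show ?thesis by simp
    qed
    \<comment> \<open>This h is extremal in Hoelder's inequality for the step function: the pairing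
      is H / N^(p-1) = N, up to the factor 1/2.\<close>
    have "ennreal (H powr (1 / p) / 2) = ennreal (\<Sum>k<K. b k powr (p - 1) * (norm (\<alpha> k) / 2) * (u (Suc k) - u k))"
    proof -
      have "b k powr (p - 1) * norm (\<alpha> k) = norm (\<alpha> k) powr p / N powr (p - 1)" for k
        using N p by (cases "\<alpha> k = 0") (auto simp: b_def powr_divide powr_diff)
      then have "(\<Sum>k<K. b k powr (p - 1) * (norm (\<alpha> k) / 2) * (u (Suc k) - u k)) = H / N powr (p - 1) / 2"
        unfolding H sum_divide_distrib by (intro sum.cong) simp_all
      also have "H / N powr (p - 1) = N" using N by (simp add: powr_diff flip: N(2))
      finally have eq: "(\<Sum>k<K. b k powr (p - 1) * (norm (\<alpha> k) / 2) * (u (Suc k) - u k)) = N / 2" .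
      show ?thesis by (simp only: eq N_def)
    qed
    also have "\<dots> = (\<Sum>k<K. ennreal (b k powr (p - 1)) * ennreal (norm (\<alpha> k) / 2) * emeasure lborel (I k))"
      using u_less
      by (simp add: I_em ennreal_mult less_imp_le del: times_divide_eq_left times_divide_eq_right flip: sum_ennreal)
    also have "\<dots> = (\<integral>\<^sup>+r. (\<Sum>k<K. ennreal (b k powr (p - 1)) * ennreal (norm (\<alpha> k) / 2) * indicator (I k) r) \<partial>lborel)"
      by (simp add: nn_integral_sum nn_integral_cmult_indicator del: sum_mult_indicator)
    also have "\<dots> \<le> (\<integral>\<^sup>+r. ennreal (h r powr (p - 1)) * m r \<partial>lborel)"
    proof (intro nn_integral_mono)
      fix r
      have "(\<Sum>k<K. ennreal (b k powr (p - 1)) * ennreal (norm (\<alpha> k) / 2) * indicator (I k) r)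
         \<le> (\<Sum>k<K. ennreal (b k powr (p - 1)) * indicator (I k) r * m r)"
        using m_ge by (intro sum_mono) (auto simp: indicator_def intro!: mult_left_mono)
      then show "(\<Sum>k<K. ennreal (b k powr (p - 1)) * ennreal (norm (\<alpha> k) / 2) * indicator (I k) r)
         \<le> ennreal (h r powr (p - 1)) * m r"
        by (simp only: h_powr sum_distrib_right)
    qed
    also have "\<dots> = (\<integral>\<^sup>+r. (\<integral>\<^sup>+t. ennreal (h r powr (p - 1)) * (ennreal (1 / (2 * pi)) * (ennreal (polar_norm f r t) * indicator {0..2 * pi} t)) \<partial>lborel) \<partial>lborel)"
      unfolding m_def by (simp add: nn_integral_cmult)
    \<comment> \<open>Tonelli: from here r is the inner variable, so that Hoelder can be applied on
      each ray.\<close>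
    also have "\<dots> = (\<integral>\<^sup>+t. (\<integral>\<^sup>+r. ennreal (h r powr (p - 1)) * (ennreal (1 / (2 * pi)) * (ennreal (polar_norm f r t) * indicator {0..2 * pi} t)) \<partial>lborel) \<partial>lborel)"
      by (rule lborel_pair.Fubini'[symmetric]) measurable
    also have "\<dots> = (\<integral>\<^sup>+t. (\<integral>\<^sup>+r. (ennreal (1 / (2 * pi)) * indicator {0..2 * pi} t) * (ennreal (polar_norm f r t) * ennreal (h r powr (p - 1))) \<partial>lborel) \<partial>lborel)"
      by (simp only: ac_simps)
    also have "\<dots> = (\<integral>\<^sup>+t. (ennreal (1 / (2 * pi)) * indicator {0..2 * pi} t) * (\<integral>\<^sup>+r. ennreal (polar_norm f r t) * ennreal (h r powr (p - 1)) \<partial>lborel) \<partial>lborel)"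
      by (intro nn_integral_cong nn_integral_cmult) measurable
    also have "\<dots> \<le> (\<integral>\<^sup>+t. (ennreal (1 / (2 * pi)) * indicator {0..2 * pi} t) * ennreal_powr (radial_integral p f t) (1 / p) \<partial>lborel)"
    proof (intro nn_integral_mono mult_left_mono)
      fix t
      show "(\<integral>\<^sup>+r. ennreal (polar_norm f r t) * ennreal (h r powr (p - 1)) \<partial>lborel) \<le> ennreal_powr (radial_integral p f t) (1 / p)"
        using p h1 by (subst radial_integral_eq_polar_norm) (auto intro!: holder_dual h0)
    qed auto
    also have "\<dots> = ennreal (1 / (2 * pi)) * (\<integral>\<^sup>+t \<in> {0..2 * pi}. ennreal_powr (radial_integral p f t) (1 / p) \<partial>lborel)"
    proof -
      have [measurable]: "radial_integral p f \<in> borel_measurable lborel"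
        using p cont by (intro measurable_radial_integral) auto
      show ?thesis by (subst nn_integral_cmult[symmetric]) (auto simp: ac_simps)
    qed
    finally show ?thesis by (simp add: f_def)
  qed simp
qed

text \<open>By lacunarity the block lengths are at least (1 - 1/l)/2 times 1/n_k; the factor 2^p
  comes from the loss of 1/2 in the block estimate. The bound is uniform in the number of blocks, so
  it holds for the full series, finite or not.\<close>

lemma coeff_sum_le_circle_mean_powr:
  assumes conv: "converges_in_disc n \<alpha>" and p: "1 \<le> p"
  defines "R \<equiv> ennreal (1 / (2 * pi)) *
    (\<integral>\<^sup>+t \<in> {0..2 * pi}. ennreal_powr (radial_integral p (gap_series n \<alpha>) t) (1 / p) \<partial>lborel)"
  shows "ennreal (((1 - 1 / l) / 2) / 2 powr p) * (\<Sum>k. ennreal (norm (\<alpha> k) powr p / real (n k))) \<le> ennreal_powr R p"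
proof -
  define c where "c = ((1 - 1 / l) / 2) / 2 powr p"
  have c: "0 \<le> c" using l by (simp add: c_def)
  have "(\<Sum>k<K. ennreal c * ennreal (norm (\<alpha> k) powr p / real (n k))) \<le> ennreal_powr R p" for K
  proof -
    define H where "H = (\<Sum>k<K. norm (\<alpha> k) powr p * (1 / (2 * real (n k)) - 1 / (2 * real (n (Suc k)))))"
    have "(\<Sum>k<K. c * (norm (\<alpha> k) powr p / real (n k))) \<le> H / 2 powr p"
      unfolding H_def sum_divide_distrib
    proof (intro sum_mono)
      fix k
      have "1 / real (n (Suc k)) \<le> 1 / (l * real (n k))"
        using n_step[of k] n_pos[of k] n_pos[of "Suc k"] l by (intro divide_left_mono) auto
      then have "(1 - 1 / l) / 2 / real (n k) \<le> 1 / (2 * real (n k)) - 1 / (2 * real (n (Suc k)))"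
        using n_pos[of k] l by (simp add: diff_divide_distrib)
      then have "norm (\<alpha> k) powr p * ((1 - 1 / l) / 2 / real (n k)) / 2 powr p \<le>
          norm (\<alpha> k) powr p * (1 / (2 * real (n k)) - 1 / (2 * real (n (Suc k)))) / 2 powr p"
        by (intro divide_right_mono mult_left_mono) auto
      moreover have "c * (norm (\<alpha> k) powr p / real (n k)) = norm (\<alpha> k) powr p * ((1 - 1 / l) / 2 / real (n k)) / 2 powr p"
        by (simp add: c_def ac_simps)
      ultimately show "c * (norm (\<alpha> k) powr p / real (n k)) \<le>
          norm (\<alpha> k) powr p * (1 / (2 * real (n k)) - 1 / (2 * real (n (Suc k)))) / 2 powr p"
        by simp
    qed
    moreover have "0 \<le> H"
      unfolding H_def using strict_monoD[OF strict_mono_n] n_pos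
      by (intro sum_nonneg mult_nonneg_nonneg) (auto simp: field_simps less_imp_le)
    ultimately have "ennreal (\<Sum>k<K. c * (norm (\<alpha> k) powr p / real (n k))) \<le> ennreal ((H powr (1 / p) / 2) powr p)"
      using p by (intro ennreal_leI) (simp add: powr_divide powr_powr)
    also have "\<dots> = ennreal_powr (ennreal (H powr (1 / p) / 2)) p" by (simp add: ennreal_powr_ennreal)
    also have "\<dots> \<le> ennreal_powr R p"
      unfolding R_def H_def using p by (intro ennreal_powr_mono gap_block_sum_le_circle_mean conv) auto
    also have "ennreal (\<Sum>k<K. c * (norm (\<alpha> k) powr p / real (n k)))
        = (\<Sum>k<K. ennreal (c * (norm (\<alpha> k) powr p / real (n k))))"
      using c by (intro sum_ennreal[symmetric]) auto
    also have "\<dots> = (\<Sum>k<K. ennreal c * ennreal (norm (\<alpha> k) powr p / real (n k)))"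
      using c by (intro sum.cong ennreal_mult) auto
    finally show ?thesis .
  qed
  then have "(\<Sum>k. ennreal c * ennreal (norm (\<alpha> k) powr p / real (n k))) \<le> ennreal_powr R p"
    by (intro suminf_le_const) auto
  then show ?thesis by (simp add: c_def)
qed

section \<open>Two-sided estimate and membership in \<open>RM\<close>\<close>

lemma rho_gap_series_le:
  assumes p: "1 \<le> p" and q: "1 \<le> q" and conv: "converges_in_disc n \<alpha>"
  shows "rho p q (gap_series n \<alpha>) \<le>
    ennreal (((2 / (1 - 1 / l powr (1 / (2 * p)))) powr (p - 1) * 3) powr (1 / p)) *
      ennreal_powr (\<Sum>k. ennreal (norm (\<alpha> k) powr p / real (n k))) (1 / p)"
proof -
  have "1 < l powr (1 / (2 * p))" using l p by (simp add: gr_one_powr)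
  then have "0 < (2 / (1 - 1 / l powr (1 / (2 * p)))) powr (p - 1) * 3" by simp
  note cmult = ennreal_powr_cmult[OF this]
  show ?thesis
    unfolding cmult[symmetric]
    by (intro rho_le radial_integral_gap_series_le summable_norm_gap_series p q conv
        holomorphic_on_imp_continuous_on holomorphic_gap_series)
qed

lemma rho_gap_series_ge:
  assumes p: "1 \<le> p" and q: "1 \<le> q" and conv: "converges_in_disc n \<alpha>"
  shows "ennreal ((((1 - 1 / l) / 2) / 2 powr p) powr (1 / p)) *
      ennreal_powr (\<Sum>k. ennreal (norm (\<alpha> k) powr p / real (n k))) (1 / p)
    \<le> rho p q (gap_series n \<alpha>)"
proof -
  let ?R = "ennreal (1 / (2 * pi)) *
    (\<integral>\<^sup>+t \<in> {0..2 * pi}. ennreal_powr (radial_integral p (gap_series n \<alpha>) t) (1 / p) \<partial>lborel)"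
  have "0 < ((1 - 1 / l) / 2) / 2 powr p" using l by simp
  note cmult = ennreal_powr_cmult[OF this]
  have "ennreal_powr (ennreal (((1 - 1 / l) / 2) / 2 powr p) * (\<Sum>k. ennreal (norm (\<alpha> k) powr p / real (n k)))) (1 / p)
      \<le> ennreal_powr (ennreal_powr ?R p) (1 / p)"
    using p by (intro ennreal_powr_mono coeff_sum_le_circle_mean_powr conv) auto
  also have "\<dots> = ?R" using p by (simp add: ennreal_powr_powr)
  also have "\<dots> \<le> rho p q (gap_series n \<alpha>)"
    by (intro circle_mean_le_rho p q conv holomorphic_on_imp_continuous_on holomorphic_gap_series)
  finally show ?thesis unfolding cmult .
qed

lemma gap_series_in_RM_iff:
  assumes p: "1 \<le> p" and q: "1 \<le> q"
  shows "converges_in_disc n \<alpha> \<and> gap_series n \<alpha> \<in> RM p q \<longleftrightarrow>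
    summable (\<lambda>k. norm (\<alpha> k) powr p / real (n k))"
proof
  assume *: "converges_in_disc n \<alpha> \<and> gap_series n \<alpha> \<in> RM p q"
  define c where "c = (((1 - 1 / l) / 2) / 2 powr p) powr (1 / p)"
  have c: "0 < c" using l by (simp add: c_def)
  have "ennreal c * ennreal_powr (\<Sum>k. ennreal (norm (\<alpha> k) powr p / real (n k))) (1 / p) < top"
    unfolding c_def by (rule le_less_trans[OF rho_gap_series_ge[OF p q]]) (use * in \<open>simp_all add: RM_def\<close>)
  then have "ennreal_powr (\<Sum>k. ennreal (norm (\<alpha> k) powr p / real (n k))) (1 / p) < top"
    using c by (auto simp: ennreal_mult_less_top)
  then have "(\<Sum>k. ennreal (norm (\<alpha> k) powr p / real (n k))) \<noteq> top"
    by (simp add: ennreal_powr_less_top_iff)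
  then show "summable (\<lambda>k. norm (\<alpha> k) powr p / real (n k))"
    by (intro summable_suminf_not_top) auto
next
  assume S: "summable (\<lambda>k. norm (\<alpha> k) powr p / real (n k))"
  \<comment> \<open>Convergence comes first, since the upper bound for \<open>rho\<close>
    presupposes it.\<close>
  have conv: "converges_in_disc n \<alpha>"
    unfolding converges_in_disc_def
  proof
    fix z :: complex assume "z \<in> ball 0 1"
    then have "summable (\<lambda>k. norm (\<alpha> k) * norm z ^ n k)"
      by (intro summable_norm_gap_series_of_coeff[OF p S]) auto
    then show "summable (\<lambda>k. \<alpha> k * z ^ n k)"
      by (intro summable_norm_cancel[of "\<lambda>k. \<alpha> k * z ^ n k"]) (simp add: norm_mult norm_power)
  qed
  have "(\<Sum>k. ennreal (norm (\<alpha> k) powr p / real (n k))) < top"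
    unfolding less_top[symmetric] by (intro ennreal_suminf_neq_top S) simp
  then have "rho p q (gap_series n \<alpha>) < top"
    by (intro le_less_trans[OF rho_gap_series_le[OF p q conv]])
       (simp add: ennreal_mult_less_top ennreal_powr_less_top_iff)
  then show "converges_in_disc n \<alpha> \<and> gap_series n \<alpha> \<in> RM p q"
    using conv holomorphic_gap_series by (simp add: RM_def)
qed

end

theorem proposition2p5:
  fixes n :: "nat \<Rightarrow> nat" and p :: real and q :: ennreal
  assumes "lacunary (\<lambda>k. real (n k))"
    and "1 \<le> p"
    and "1 \<le> q"
  shows "(\<forall>\<alpha> :: nat \<Rightarrow> complex.
            (converges_in_disc n \<alpha> \<and> gap_series n \<alpha> \<in> RM p q) \<longleftrightarrow>
            summable (\<lambda>k. norm (\<alpha> k) powr p / real (n k))) \<and>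
         (\<exists>C::real. C > 0 \<and>
            (\<forall>\<alpha> :: nat \<Rightarrow> complex. converges_in_disc n \<alpha> \<longrightarrow>
               ennreal (1 / C) * ennreal_powr (\<Sum>k. ennreal (norm (\<alpha> k) powr p / real (n k))) (1 / p)
                 \<le> rho p q (gap_series n \<alpha>) \<and>
               rho p q (gap_series n \<alpha>)
                 \<le> ennreal C * ennreal_powr (\<Sum>k. ennreal (norm (\<alpha> k) powr p / real (n k))) (1 / p)))"
proof -
  obtain l where l: "1 < l" and pos: "\<And>k. 0 < real (n k)" and ratio: "\<And>k. l \<le> real (n (Suc k)) / real (n k)"
    using assms(1) by (auto simp: lacunary_def)
  interpret gap_exponents n l
  proof
    show "0 < n k" for k using pos[of k] by simp
    show "l * real (n k) \<le> real (n (Suc k))" for k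
      using ratio[of k] pos[of k] by (simp add: pos_le_divide_eq)
  qed (fact l)
  define C\<^sub>1 where "C\<^sub>1 = (((1 - 1 / l) / 2) / 2 powr p) powr (1 / p)"
  define C\<^sub>2 where "C\<^sub>2 = ((2 / (1 - 1 / l powr (1 / (2 * p)))) powr (p - 1) * 3) powr (1 / p)"
  \<comment> \<open>One constant for both bounds: the lower one needs 1/C \<le>
    \<open>C\<^sub>1\<close>, the upper one \<open>C\<^sub>2\<close> \<le> C. It is fixed before
    \<alpha>.\<close>
  define C where "C = max (1 / C\<^sub>1) C\<^sub>2"
  have C1: "0 < C\<^sub>1" using l by (simp add: C\<^sub>1_def)
  have "1 / C\<^sub>1 \<le> C" "C\<^sub>2 \<le> C" by (simp_all add: C_def)
  moreover from this have "0 < C" using C1 by (smt (verit) divide_pos_pos)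
  ultimately have C: "0 < C" "1 / C \<le> C\<^sub>1" "C\<^sub>2 \<le> C"
    using C1 by (simp_all add: field_simps)
  show ?thesis
  proof (intro conjI exI[of _ C] allI impI gap_series_in_RM_iff assms(2,3) C(1))
    fix \<alpha> :: "nat \<Rightarrow> complex" assume conv: "converges_in_disc n \<alpha>"
    let ?S = "ennreal_powr (\<Sum>k. ennreal (norm (\<alpha> k) powr p / real (n k))) (1 / p)"
    have "ennreal (1 / C) * ?S \<le> ennreal C\<^sub>1 * ?S"
      using C by (intro mult_right_mono ennreal_leI) auto
    also have "\<dots> \<le> rho p q (gap_series n \<alpha>)"
      unfolding C\<^sub>1_def by (rule rho_gap_series_ge[OF assms(2,3) conv])
    finally show "ennreal (1 / C) * ?S \<le> rho p q (gap_series n \<alpha>)" .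
    have "rho p q (gap_series n \<alpha>) \<le> ennreal C\<^sub>2 * ?S"
      unfolding C\<^sub>2_def by (rule rho_gap_series_le[OF assms(2,3) conv])
    also have "\<dots> \<le> ennreal C * ?S"
      using C by (intro mult_right_mono ennreal_leI) auto
    finally show "rho p q (gap_series n \<alpha>) \<le> ennreal C * ?S" .
  qed
qed

end
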